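(* A curve is a general helix if and only if it is a successor curve of a plane curve and is not itself a plane curve.
   Context: All curves are unit speed (arc-length parametrized) $C^2$ curves in $\mathbb R^3$ defined on an interval. A plane curve is a curve lying on a plane; straight lines are plane curves. A curve is called a general helix if at every point its unit tangent vector makes a constant angle $\theta\in(0,\pi/2)$ with a fixed direction given by a unit vector $\mathbf D_0$; by convention straight lines and plane curves are excluded from the general helices. A principal normal of a curve with unit tangent $\mathbf T$ is a $C^1$ unit vector field $\mathbf N$ along it with $\mathbf N\perp\mathbf T$ and $\mathbf T'(s)$ a scalar multiple of $\mathbf N(s)$ for all $s$ (the scalar may be zero). Given a unit speed $C^2$ curve $\mathbf x=\mathbf x(s)$ with unit tangent $\mathbf T$, a curve $\mathbf x_1=\mathbf x_1(s)$ with the same arc length parameter is called a successor curve of $\mathbf x$ if $\mathbf T$ is a principal normal of $\mathbf x_1$. *)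

theory Defs
  imports "HOL-Analysis.Analysis"
begin

text \<open>
  A curve is a map \<open>x\<close> together with its parameter interval \<open>I\<close>, an arbitrary nondegenerate
  interval (open, closed, half-open, bounded or not). All derivatives are taken within \<open>I\<close>, so they
  are one-sided at an endpoint belonging to \<open>I\<close>; the values of \<open>x\<close> outside \<open>I\<close> are irrelevant.
\<close>

definition C1_within :: "real set \<Rightarrow> (real \<Rightarrow> real ^ 3) \<Rightarrow> bool" where
  "C1_within I f \<longleftrightarrow>
     (\<forall>s\<in>I. f differentiable (at s within I)) \<and>
     continuous_on I (\<lambda>s. vector_derivative f (at s within I))"

definition tangent :: "real set \<Rightarrow> (real \<Rightarrow> real ^ 3) \<Rightarrow> real \<Rightarrow> real ^ 3" where
  "tangent I x s = vector_derivative x (at s within I)"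

definition unit_speed_C2_curve :: "real set \<Rightarrow> (real \<Rightarrow> real ^ 3) \<Rightarrow> bool" where
  "unit_speed_C2_curve I x \<longleftrightarrow>
     is_interval I \<and> interior I \<noteq> {} \<and>
     C1_within I x \<and> C1_within I (tangent I x) \<and>
     (\<forall>s\<in>I. norm (tangent I x s) = 1)"

text \<open>Straight lines satisfy this definition, since every line is contained in a plane.\<close>

definition plane_curve :: "real set \<Rightarrow> (real \<Rightarrow> real ^ 3) \<Rightarrow> bool" where
  "plane_curve I x \<longleftrightarrow>
     unit_speed_C2_curve I x \<and> (\<exists>P. affine P \<and> aff_dim P = 2 \<and> x ` I \<subseteq> P)"

text \<open>For unit vectors, the angle is \<open>\<theta>\<close> in \<open>[0, \<pi>]\<close> iff the inner product is \<open>cos \<theta>\<close>.\<close>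

definition general_helix :: "real set \<Rightarrow> (real \<Rightarrow> real ^ 3) \<Rightarrow> bool" where
  "general_helix I x \<longleftrightarrow>
     unit_speed_C2_curve I x \<and> \<not> plane_curve I x \<and>
     (\<exists>D0 \<theta>. norm D0 = 1 \<and> 0 < \<theta> \<and> \<theta> < pi / 2 \<and>
        (\<forall>s\<in>I. tangent I x s \<bullet> D0 = cos \<theta>))"

definition principal_normal ::
    "real set \<Rightarrow> (real \<Rightarrow> real ^ 3) \<Rightarrow> (real \<Rightarrow> real ^ 3) \<Rightarrow> bool" where
  "principal_normal I x N \<longleftrightarrow>
     C1_within I N \<and>
     (\<forall>s\<in>I. norm (N s) = 1 \<and> N s \<bullet> tangent I x s = 0 \<and>
        (\<exists>k. vector_derivative (tangent I x) (at s within I) = k *\<^sub>R N s))"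

text \<open>\<open>successor_curve I x x1\<close>: \<open>x1\<close> is a successor curve of \<open>x\<close>.\<close>

definition successor_curve ::
    "real set \<Rightarrow> (real \<Rightarrow> real ^ 3) \<Rightarrow> (real \<Rightarrow> real ^ 3) \<Rightarrow> bool" where
  "successor_curve I x x1 \<longleftrightarrow>
     unit_speed_C2_curve I x \<and> unit_speed_C2_curve I x1 \<and>
     principal_normal I x1 (tangent I x)"

end

theory Submission
  imports Defs
begin

text \<open>
  Everything happens on the level of the unit tangent. A unit speed curve is plane exactly if some
  unit vector is orthogonal to all of its tangents (\<open>plane_curve_iff\<close>), so both sides of the
  equivalence speak about inner products of tangents with one fixed vector.

  Suppose that the tangent \<open>T\<^sub>1\<close> of a helix makes the constant angle \<open>\<theta>\<close> with \<open>D\<close>.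
  Then \<open>T\<^sub>1'\<close> is orthogonal to \<open>D\<close>, and to \<open>T\<^sub>1\<close> because \<open>T\<^sub>1\<close> has constant length; hence it is
  parallel to \<open>D \<times> T\<^sub>1\<close>, whose length is constantly \<open>sin \<theta> > 0\<close>. The normalized vector field
  \<open>N = (D \<times> T\<^sub>1) / sin \<theta>\<close> is therefore a principal normal, and any antiderivative of \<open>N\<close> is a unit
  speed curve whose tangent \<open>N\<close> is orthogonal to \<open>D\<close>, hence a plane curve having the helix as a successor.

  Conversely, let the tangent \<open>T\<close> of a plane curve, orthogonal to a unit vector \<open>D\<close>, be a principal
  normal of the curve with tangent \<open>T\<^sub>1\<close>. Then \<open>T\<^sub>1'\<close> is a multiple of \<open>T\<close>, so \<open>T\<^sub>1 \<bullet> D\<close> is a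
  constant \<open>c\<close>. The reversal of \<open>D\<close> achieves \<open>c \<ge> 0\<close>, and the extreme values \<open>c = 0\<close>
  (curve in a plane orthogonal to \<open>D\<close>) and \<open>c = 1\<close> (straight line) belong to plane curves. In all
  other cases \<open>c = cos \<theta>\<close> with \<open>0 < \<theta> < \<pi>/2\<close>.
\<close>

section \<open>Calculus on an interval\<close>

lemma at_within_interval_ne_bot:
  fixes I :: "real set"
  assumes "is_interval I" "interior I \<noteq> {}" "s \<in> I"
  shows "at s within I \<noteq> bot"
proof -
  have "I \<noteq> {x}" for x
    using assms(2) by auto
  then have "s islimpt I"
    using assms connected_imp_perfect is_interval_connected by blast
  then show ?thesis
    by (simp add: trivial_limit_within)
qed

text \<open>
  The integral from a fixed base point \<open>a\<close> is an antiderivative. The fundamental theorem is available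
  on compact intervals; near \<open>s\<close> the interval \<open>I\<close> coincides with a compact subinterval containing
  \<open>a\<close> and \<open>s\<close>, one of whose ends is \<open>s\<close> only if \<open>s\<close> is an endpoint of \<open>I\<close>.
\<close>

lemma antiderivative_on_interval:
  fixes f :: "real \<Rightarrow> 'a::euclidean_space"
  assumes I: "is_interval I" and f: "continuous_on I f"
  obtains F where "\<And>s. s \<in> I \<Longrightarrow> (F has_vector_derivative f s) (at s within I)"
proof (cases "I = {}")
  case True
  then show ?thesis using that by blast
next
  case False
  then obtain a where a: "a \<in> I" by blast
  define F where "F u = (LBINT y=a..u. f y)" for u :: real
  have "(F has_vector_derivative f s) (at s within I)" if s: "s \<in> I" for s
  proof -
    obtain c where c: "c \<in> I" "c \<le> a" "c \<le> s" "c < s \<or> (\<forall>y\<in>I. s \<le> y)"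
    proof (cases "\<exists>y\<in>I. y < s")
      case True
      then obtain y where "y \<in> I" "y < s" by blast
      then show ?thesis using a by (intro that[of "min a y"]) (auto simp: min_def)
    next
      case False
      then show ?thesis using a s by (intro that[of s]) (auto simp: not_less)
    qed
    obtain d where d: "d \<in> I" "a \<le> d" "s \<le> d" "s < d \<or> (\<forall>y\<in>I. y \<le> s)"
    proof (cases "\<exists>y\<in>I. s < y")
      case True
      then obtain y where "y \<in> I" "s < y" by blast
      then show ?thesis using a by (intro that[of "max a y"]) (auto simp: max_def)
    next
      case False
      then show ?thesis using a s by (intro that[of s]) (auto simp: not_less)
    qed
    have sub: "{c..d} \<subseteq> I"
      using I c(1) d(1) by (meson atLeastAtMost_iff mem_is_interval_1_I subsetI)
    define U where "U = (if c < s then {c<..} else UNIV) \<inter> (if s < d then {..<d} else UNIV)"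
    have "open U" "s \<in> U"
      by (auto simp: U_def)
    moreover have "I \<inter> U - {s} = {c..d} \<inter> U - {s}"
    proof -
      have "y \<in> {c..d}" if "y \<in> I" "y \<in> U" for y
        using that c d by (fastforce simp: U_def split: if_splits)
      then show ?thesis using sub by blast
    qed
    ultimately have eq: "at s within I = at s within {c..d}"
      by (metis at_within_nhd)
    have "(F has_vector_derivative f s) (at s within {c..d})"
      unfolding F_def using c d sub continuous_on_subset[OF f]
      by (intro interval_integral_FTC2) auto
    then show ?thesis by (simp add: eq)
  qed
  then show ?thesis by (rule that)
qed

lemma inner_constant_iff_derivative_orthogonal:
  fixes f :: "real \<Rightarrow> 'a::real_inner"
  assumes I: "is_interval I" "interior I \<noteq> {}"
    and f: "\<And>s. s \<in> I \<Longrightarrow> (f has_vector_derivative f' s) (at s within I)"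
  shows "(\<exists>c. \<forall>s\<in>I. f s \<bullet> D = c) \<longleftrightarrow> (\<forall>s\<in>I. f' s \<bullet> D = 0)"
proof -
  have deriv: "((\<lambda>s. f s \<bullet> D) has_vector_derivative f' s \<bullet> D) (at s within I)" if "s \<in> I" for s
    using bounded_linear.has_vector_derivative[OF bounded_linear_inner_left f[OF that]] .
  show ?thesis
  proof
    assume "\<exists>c. \<forall>s\<in>I. f s \<bullet> D = c"
    then obtain c where c: "\<And>s. s \<in> I \<Longrightarrow> c = f s \<bullet> D" by metis
    show "\<forall>s\<in>I. f' s \<bullet> D = 0"
    proof
      fix s assume s: "s \<in> I"
      have "((\<lambda>s. c) has_vector_derivative f' s \<bullet> D) (at s within I)"
        using has_vector_derivative_transform[OF s c deriv[OF s]] .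
      then show "f' s \<bullet> D = 0"
        using vector_derivative_unique_within[OF at_within_interval_ne_bot[OF I s]]
          has_vector_derivative_const by blast
    qed
  next
    assume 0: "\<forall>s\<in>I. f' s \<bullet> D = 0"
    show "\<exists>c. \<forall>s\<in>I. f s \<bullet> D = c"
    proof (rule has_vector_derivative_zero_constant)
      show "convex I" using I(1) by (rule is_interval_convex)
      show "((\<lambda>s. f s \<bullet> D) has_vector_derivative 0) (at s within I)" if "s \<in> I" for s
        using deriv[OF that] 0 that by simp
    qed blast
  qed
qed

lemma derivative_orthogonal_of_unit_norm:
  fixes f :: "real \<Rightarrow> 'a::real_inner"
  assumes I: "is_interval I" "interior I \<noteq> {}" and s: "s \<in> I"
    and f: "(f has_vector_derivative f') (at s within I)"
    and norm: "\<And>t. t \<in> I \<Longrightarrow> norm (f t) = 1"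
  shows "f' \<bullet> f s = 0"
proof -
  have "((\<lambda>t. f t \<bullet> f t) has_vector_derivative f s \<bullet> f' + f' \<bullet> f s) (at s within I)"
    using bounded_bilinear.has_vector_derivative[OF bounded_bilinear_inner f f] .
  moreover have "1 = f t \<bullet> f t" if "t \<in> I" for t
    using norm[OF that] by (simp add: norm_eq_1)
  ultimately have "((\<lambda>t. 1) has_vector_derivative f s \<bullet> f' + f' \<bullet> f s) (at s within I)"
    by (rule has_vector_derivative_transform[OF s, rotated])
  then have "f s \<bullet> f' + f' \<bullet> f s = 0"
    using vector_derivative_unique_within[OF at_within_interval_ne_bot[OF I s]]
      has_vector_derivative_const by blast
  then show ?thesis by (simp add: inner_commute)
qed

section \<open>Unit speed curves and plane curves\<close>

lemma C1_within_has_vector_derivative: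
  assumes "C1_within I f" "s \<in> I"
  shows "(f has_vector_derivative vector_derivative f (at s within I)) (at s within I)"
  using assms by (simp add: C1_within_def vector_derivative_works)

lemma unit_speed_C2_curveD:
  assumes "unit_speed_C2_curve I x"
  shows "is_interval I" "interior I \<noteq> {}"
    and "\<And>s. s \<in> I \<Longrightarrow> (x has_vector_derivative tangent I x s) (at s within I)"
    and "\<And>s. s \<in> I \<Longrightarrow> (tangent I x has_vector_derivative
           vector_derivative (tangent I x) (at s within I)) (at s within I)"
    and "continuous_on I (\<lambda>s. vector_derivative (tangent I x) (at s within I))"
    and "\<And>s. s \<in> I \<Longrightarrow> norm (tangent I x s) = 1"
  using assms C1_within_has_vector_derivative
  by (auto simp: unit_speed_C2_curve_def tangent_def[symmetric] C1_within_def
      vector_derivative_works)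

lemma C1_withinI:
  assumes I: "is_interval I" "interior I \<noteq> {}"
    and f: "\<And>s. s \<in> I \<Longrightarrow> (f has_vector_derivative f' s) (at s within I)"
    and cont: "continuous_on I f'"
  shows "C1_within I f"
proof -
  have "vector_derivative f (at s within I) = f' s" if "s \<in> I" for s
    using vector_derivative_within[OF at_within_interval_ne_bot[OF I that] f[OF that]] .
  then have "continuous_on I (\<lambda>s. vector_derivative f (at s within I))"
    using cont by (simp cong: continuous_on_cong)
  then show ?thesis
    using f by (auto simp: C1_within_def intro: differentiableI_vector)
qed

text \<open>
  The values of \<open>tangent I x\<close> outside \<open>I\<close> are junk, so a prescribed vector field \<open>T\<close> is recovered as
  the tangent of its antiderivative only on \<open>I\<close>.
\<close>

lemma unit_speed_C2_curveI:
  assumes I: "is_interval I" "interior I \<noteq> {}"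
    and x: "\<And>s. s \<in> I \<Longrightarrow> (x has_vector_derivative T s) (at s within I)"
    and T: "\<And>s. s \<in> I \<Longrightarrow> (T has_vector_derivative T' s) (at s within I)"
    and cont: "continuous_on I T'"
    and norm: "\<And>s. s \<in> I \<Longrightarrow> norm (T s) = 1"
  shows "unit_speed_C2_curve I x" and "\<And>s. s \<in> I \<Longrightarrow> tangent I x s = T s"
proof -
  show tan: "tangent I x s = T s" if "s \<in> I" for s
    unfolding tangent_def
    using vector_derivative_within[OF at_within_interval_ne_bot[OF I that] x[OF that]] .
  have "continuous_on I T"
    using T by (rule continuous_on_vector_derivative)
  with x have "C1_within I x"
    by (rule C1_withinI[OF I])
  moreover have "C1_within I (tangent I x)"
    using has_vector_derivative_transform[OF _ tan T] by (rule C1_withinI[OF I _ cont])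
  ultimately show "unit_speed_C2_curve I x"
    using I tan norm by (simp add: unit_speed_C2_curve_def)
qed

text \<open>
  Planes are the level sets of \<open>\<lambda>y. y \<bullet> D\<close>, and \<open>x \<bullet> D\<close> is constant exactly if its derivative
  \<open>T \<bullet> D\<close> vanishes.
\<close>

lemma plane_curve_iff:
  assumes x: "unit_speed_C2_curve I x"
  shows "plane_curve I x \<longleftrightarrow> (\<exists>D. norm D = 1 \<and> (\<forall>s\<in>I. tangent I x s \<bullet> D = 0))"
proof -
  note constant_iff = inner_constant_iff_derivative_orthogonal[OF unit_speed_C2_curveD(1-3)[OF x]]
  show ?thesis
  proof
    assume "plane_curve I x"
    then obtain P where P: "affine P" "aff_dim P = 2" "x ` I \<subseteq> P"
      by (auto simp: plane_curve_def)
    then obtain a b where a: "a \<noteq> 0" and Pab: "P = {y. a \<bullet> y = b}"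
      using aff_dim_eq_hyperplane[of P] by (auto simp: hull_same)
    have "\<exists>c. \<forall>s\<in>I. x s \<bullet> a = c"
      using P(3) Pab by (intro exI[of _ b]) (auto simp: inner_commute)
    then have "\<forall>s\<in>I. tangent I x s \<bullet> a = 0"
      using constant_iff by simp
    then show "\<exists>D. norm D = 1 \<and> (\<forall>s\<in>I. tangent I x s \<bullet> D = 0)"
      using a by (intro exI[of _ "sgn a"]) (simp add: norm_sgn sgn_div_norm)
  next
    assume "\<exists>D. norm D = 1 \<and> (\<forall>s\<in>I. tangent I x s \<bullet> D = 0)"
    then obtain D where D: "D \<noteq> 0" "\<forall>s\<in>I. tangent I x s \<bullet> D = 0"
      by (metis norm_zero zero_neq_one)
    then obtain c where c: "\<forall>s\<in>I. x s \<bullet> D = c"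
      using constant_iff by blast
    have "aff_dim {y. D \<bullet> y = c} = 2"
      using D(1) by simp
    moreover have "x ` I \<subseteq> {y. D \<bullet> y = c}"
      using c by (auto simp: inner_commute)
    ultimately show "plane_curve I x"
      unfolding plane_curve_def
      using x by (intro conjI exI[of _ "{y. D \<bullet> y = c}"]) (auto simp: affine_hyperplane)
  qed
qed

text \<open>A normal of a plane containing the line is any vector orthogonal to its direction.\<close>

lemma plane_curve_if_tangent_constant:
  assumes x: "unit_speed_C2_curve I x" and D: "\<And>s. s \<in> I \<Longrightarrow> tangent I x s = D"
  shows "plane_curve I x"
proof -
  obtain E :: "real ^ 3" where "E \<noteq> 0" "orthogonal D E"
    using orthogonal_to_vector_exists[of D] by auto
  then have "norm (sgn E) = 1" "\<forall>s\<in>I. tangent I x s \<bullet> sgn E = 0"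
    using D by (auto simp: norm_sgn sgn_div_norm orthogonal_def)
  then show ?thesis
    using plane_curve_iff[OF x] by blast
qed

section \<open>Vectors of constant angle with an axis\<close>

text \<open>By the expansion \<open>v \<times> (D \<times> t) = (v \<bullet> t) D - (v \<bullet> D) t\<close>.\<close>

lemma orthogonal_to_both_imp_multiple_cross3:
  assumes "v \<bullet> D = 0" "v \<bullet> t = 0" "cross3 D t \<noteq> 0"
  obtains k where "v = k *\<^sub>R cross3 D t"
proof -
  have "cross3 v (cross3 D t) = (v \<bullet> t) *\<^sub>R D - (v \<bullet> D) *\<^sub>R t"
    by (simp add: cross3_simps) (simp add: forall_3 algebra_simps)
  then have "cross3 (cross3 D t) v = 0"
    using assms(1,2) cross_skew[of "cross3 D t" v] by simp
  then show ?thesis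
    using that[of 0] that assms(3) by (auto simp: cross_eq_0 collinear_lemma)
qed

lemma norm_cross3_unit_vectors:
  assumes "norm D = 1" "norm t = 1" "t \<bullet> D = cos \<theta>" "0 \<le> sin \<theta>"
  shows "norm (cross3 D t) = sin \<theta>"
proof -
  have "(norm (cross3 D t))\<^sup>2 + (cos \<theta>)\<^sup>2 = 1"
    using norm_cross_dot[of D t] assms(1-3) by (simp add: inner_commute)
  then have "(norm (cross3 D t))\<^sup>2 = (sin \<theta>)\<^sup>2"
    using sin_squared_eq[of \<theta>] by simp
  then show ?thesis
    using assms(4) by (simp add: power2_eq_iff_nonneg)
qed

section \<open>General helices as successor curves\<close>

text \<open>
  The predecessor is an antiderivative of \<open>(D \<times> T\<^sub>1) / sin \<theta>\<close>; the axis \<open>D\<close> of the helix is a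
  normal of its plane.
\<close>

lemma general_helix_imp_successor_of_plane_curve:
  assumes x1: "unit_speed_C2_curve I x1" and D: "norm D = 1"
    and \<theta>: "0 < sin \<theta>" and angle: "\<And>s. s \<in> I \<Longrightarrow> tangent I x1 s \<bullet> D = cos \<theta>"
  obtains x where "plane_curve I x" "successor_curve I x x1"
proof -
  note I = unit_speed_C2_curveD(1,2)[OF x1]
  let ?T1 = "tangent I x1"
  define T1' where "T1' s = vector_derivative ?T1 (at s within I)" for s
  have T1': "(?T1 has_vector_derivative T1' s) (at s within I)" if "s \<in> I" for s
    using unit_speed_C2_curveD(4)[OF x1 that] by (simp add: T1'_def)
  \<comment> \<open>The candidate for the principal normal is linear in the tangent, so that its derivative is
      obtained by applying the same map to \<open>T1'\<close>.\<close>
  define L where "L v = (1 / sin \<theta>) *\<^sub>R cross3 D v" for v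
  have L: "bounded_linear L"
    unfolding L_def linear_conv_bounded_linear[symmetric]
    by (intro linearI) (auto simp: cross_add_right cross_mult_right algebra_simps)
  define N where "N s = L (?T1 s)" for s
  have norm_cross: "norm (cross3 D (?T1 s)) = sin \<theta>" if "s \<in> I" for s
    using norm_cross3_unit_vectors[OF D unit_speed_C2_curveD(6)[OF x1 that] angle[OF that]] \<theta>
    by simp
  have norm_N: "norm (N s) = 1" if "s \<in> I" for s
    using norm_cross[OF that] \<theta> by (simp add: N_def L_def)
  have deriv_N: "(N has_vector_derivative L (T1' s)) (at s within I)" if "s \<in> I" for s
    unfolding N_def using bounded_linear.has_vector_derivative[OF L T1'[OF that]] .
  have cont: "continuous_on I (\<lambda>s. L (T1' s))"
    using bounded_linear.continuous_on[OF L] unit_speed_C2_curveD(5)[OF x1] by (simp add: T1'_def)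
  have "continuous_on I N"
    using deriv_N by (rule continuous_on_vector_derivative)
  then obtain x where x: "\<And>s. s \<in> I \<Longrightarrow> (x has_vector_derivative N s) (at s within I)"
    using antiderivative_on_interval[OF I(1)] by metis
  have x_C2: "unit_speed_C2_curve I x"
    using x deriv_N cont norm_N by (rule unit_speed_C2_curveI(1)[OF I])
  have tangent_x: "tangent I x s = N s" if "s \<in> I" for s
    using x deriv_N cont norm_N that by (rule unit_speed_C2_curveI(2)[OF I])
  have "plane_curve I x"
    using plane_curve_iff[OF x_C2] D tangent_x
    by (auto simp: N_def L_def dot_cross_self intro!: exI[of _ D])
  moreover have "principal_normal I x1 (tangent I x)"
    unfolding principal_normal_def
  proof (intro conjI ballI)
    show "C1_within I (tangent I x)"
      using x_C2 by (simp add: unit_speed_C2_curve_def)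
    fix s assume s: "s \<in> I"
    show "norm (tangent I x s) = 1" "tangent I x s \<bullet> ?T1 s = 0"
      using tangent_x[OF s] norm_N[OF s] by (auto simp: N_def L_def dot_cross_self)
    have "T1' s \<bullet> D = 0"
      using inner_constant_iff_derivative_orthogonal[OF I T1'] angle s by blast
    moreover have "T1' s \<bullet> ?T1 s = 0"
      by (rule derivative_orthogonal_of_unit_norm[OF I s T1'[OF s]])
        (rule unit_speed_C2_curveD(6)[OF x1])
    moreover have "cross3 D (?T1 s) \<noteq> 0"
      using norm_cross[OF s] \<theta> by auto
    ultimately obtain k where "T1' s = k *\<^sub>R cross3 D (?T1 s)"
      by (rule orthogonal_to_both_imp_multiple_cross3)
    then have "T1' s = (k * sin \<theta>) *\<^sub>R tangent I x s"
      using tangent_x[OF s] \<theta> by (simp add: N_def L_def)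
    then show "\<exists>k. vector_derivative ?T1 (at s within I) = k *\<^sub>R tangent I x s"
      unfolding T1'_def by blast
  qed
  ultimately show ?thesis
    using that x1 x_C2 by (auto simp: successor_curve_def)
qed

text \<open>
  The vector \<open>D\<close> is a unit normal of the plane, and of the two normals the one giving a nonnegative
  constant is chosen.
\<close>

lemma tangent_inner_constant_if_successor_of_plane_curve:
  assumes "plane_curve I x" "successor_curve I x x1"
  obtains D c where "norm D = 1" "0 \<le> c" "\<And>s. s \<in> I \<Longrightarrow> tangent I x1 s \<bullet> D = c"
proof -
  have x: "unit_speed_C2_curve I x" and x1: "unit_speed_C2_curve I x1"
    and N: "principal_normal I x1 (tangent I x)"
    using assms(2) by (auto simp: successor_curve_def)
  obtain D where D: "norm D = 1" "\<And>s. s \<in> I \<Longrightarrow> tangent I x s \<bullet> D = 0"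
    using assms(1) plane_curve_iff[OF x] by blast
  have "vector_derivative (tangent I x1) (at s within I) \<bullet> D = 0" if s: "s \<in> I" for s
  proof -
    obtain k where "vector_derivative (tangent I x1) (at s within I) = k *\<^sub>R tangent I x s"
      using N s by (auto simp: principal_normal_def)
    then show ?thesis using D(2)[OF s] by simp
  qed
  then obtain c where c: "\<And>s. s \<in> I \<Longrightarrow> tangent I x1 s \<bullet> D = c"
    using inner_constant_iff_derivative_orthogonal[OF unit_speed_C2_curveD(1,2,4)[OF x1]]
    by metis
  show ?thesis
  proof (cases "0 \<le> c")
    case True
    then show ?thesis using that D(1) c by blast
  next
    case False
    then show ?thesis using that[of "- D" "- c"] D(1) c by simp
  qed
qed

text \<open>
  The constant \<open>c\<close> lies in \<open>[0, 1]\<close>; for \<open>c = 0\<close> the curve lies in a plane orthogonal to \<open>D\<close>, for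
  \<open>c = 1\<close> it is a straight line of direction \<open>D\<close>, and otherwise \<open>arccos c\<close> is an admissible angle.
\<close>

lemma general_helix_if_tangent_inner_constant:
  assumes x1: "unit_speed_C2_curve I x1" and not_plane: "\<not> plane_curve I x1"
    and D: "norm D = 1" and "0 \<le> c" and c: "\<And>s. s \<in> I \<Longrightarrow> tangent I x1 s \<bullet> D = c"
  shows "general_helix I x1"
proof -
  obtain s where s: "s \<in> I"
    using unit_speed_C2_curveD(2)[OF x1] interior_subset by blast
  have "c \<noteq> 0"
    using not_plane plane_curve_iff[OF x1] D c by blast
  have "c \<le> 1"
    using norm_cauchy_schwarz[of "tangent I x1 s" D] unit_speed_C2_curveD(6)[OF x1 s] D c[OF s]
    by simp
  have "c \<noteq> 1"
  proof
    assume "c = 1"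
    \<comment> \<open>Equality in the Cauchy-Schwarz inequality for unit vectors.\<close>
    then have "tangent I x1 t = D" if "t \<in> I" for t
      using norm_cauchy_schwarz_eq[of "tangent I x1 t" D] unit_speed_C2_curveD(6)[OF x1 that] D
        c[OF that] by simp
    then show False
      using plane_curve_if_tangent_constant[OF x1] not_plane by blast
  qed
  have "0 < arccos c" "arccos c < pi / 2" "cos (arccos c) = c"
    using \<open>0 \<le> c\<close> \<open>c \<noteq> 0\<close> \<open>c \<le> 1\<close> \<open>c \<noteq> 1\<close> arccos_lt_bounded[of c]
      arccos_less_arccos[of 0 c] by auto
  then show ?thesis
    unfolding general_helix_def using x1 not_plane D c by metis
qed

theorem theorem3p4:
  fixes I :: "real set" and x1 :: "real \<Rightarrow> real ^ 3"
  assumes "unit_speed_C2_curve I x1"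
  shows "general_helix I x1 \<longleftrightarrow>
    (\<exists>x. plane_curve I x \<and> successor_curve I x x1) \<and> \<not> plane_curve I x1"
proof (intro iffI conjI)
  assume helix: "general_helix I x1"
  then show "\<not> plane_curve I x1"
    by (simp add: general_helix_def)
  obtain D \<theta> where "norm D = 1" "0 < \<theta>" "\<theta> < pi / 2"
    and "\<And>s. s \<in> I \<Longrightarrow> tangent I x1 s \<bullet> D = cos \<theta>"
    using helix by (auto simp: general_helix_def)
  moreover from this have "0 < sin \<theta>"
    by (intro sin_gt_zero) auto
  ultimately show "\<exists>x. plane_curve I x \<and> successor_curve I x x1"
    using general_helix_imp_successor_of_plane_curve[OF assms] by metis
next
  assume "(\<exists>x. plane_curve I x \<and> successor_curve I x x1) \<and> \<not> plane_curve I x1"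
  then obtain x where "plane_curve I x" "successor_curve I x x1" "\<not> plane_curve I x1"
    by blast
  then show "general_helix I x1"
    using tangent_inner_constant_if_successor_of_plane_curve
      general_helix_if_tangent_inner_constant[OF assms] by metis
qed

end
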